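(* Let $n\in\mathbb{N}$, $q_1,\ldots,q_n\in(0,1)$, and let $d\ge2$ be a finite integer. For each $c\in\mathbb{N}$ let $X_{j,k}^{(c)}\sim\mathrm{Geo}\bigl((1-d^{k-1-c})q_j\bigr)$, $1\le j\le n$, $1\le k\le c$, be independent over $j,k$, and let $Y_{n:n}^{(c)}=\max_{1\le j\le n}\sum_{k=1}^cX_{j,k}^{(c)}$. Let $X_1,\ldots,X_n$ be independent with $X_j\sim\mathrm{Geo}(q_j)$ and $X_{n:n}=\max_jX_j$. Then $$\lim_{c\to\infty}\frac{\mathbb{E}[Y_{n:n}^{(c)}]}{c}=\frac{1}{\min_{1\le j\le n}q_j}\le\mathbb{E}[X_{n:n}].$$
   Context: $\mathrm{Geo}(q)$ is the geometric distribution on $\{1,2,\ldots\}$ with $\mathbb{P}(X=k)=(1-q)^{k-1}q$. Interpretation: $Y_{n:n}^{(c)}/c$ is the delay per packet of random linear combinations over a field of size $d$ with blocklength $c$, and $X_{n:n}$ is the delay per packet of uncoded transmission. *)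

theory Defs
  imports "HOL-Probability.Probability"
begin

text \<open>
  The geometric distribution supported on \<open>{1, 2, \<dots>}\<close> with
  \<open>P(X = k) = (1 - q)^(k - 1) * q\<close>. The library's \<^const>\<open>geometric_pmf\<close> counts failures and is
  supported on \<open>{0, 1, \<dots>}\<close>, hence the shift by \<^const>\<open>Suc\<close>.
\<close>

definition Geo :: "real \<Rightarrow> nat pmf" where
  "Geo q = map_pmf Suc (geometric_pmf q)"

lemma pmf_Geo:
  assumes "0 < q" "q \<le> 1" "k \<ge> 1"
  shows "pmf (Geo q) k = (1 - q) ^ (k - 1) * q"
proof -
  obtain m where k: "k = Suc m"
    using assms(3) by (cases k) auto
  have "pmf (Geo q) k = pmf (geometric_pmf q) m"
    unfolding Geo_def k by (rule pmf_map_inj') simp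
  then show ?thesis
    using assms(1,2) k by simp
qed

lemma pmf_Geo_0: "pmf (Geo q) 0 = 0"
  by (auto simp: Geo_def pmf_eq_0_set_pmf)

text \<open>The law of \<open>V\<close> under \<open>M\<close> is the geometric distribution with parameter \<open>q\<close>.\<close>

definition geometric_rv :: "'a measure \<Rightarrow> ('a \<Rightarrow> nat) \<Rightarrow> real \<Rightarrow> bool" where
  "geometric_rv M V q \<longleftrightarrow>
     V \<in> measurable M (count_space UNIV) \<and>
     distr M (count_space UNIV) V = measure_pmf (Geo q)"

text \<open>
  Convention: an expectation is a Bochner integral, which is \<open>0\<close> for a non-integrable function.
  A positive lower bound on an expectation, or a positive limit of expectations divided by \<open>c\<close>,
  therefore includes the claim that the variable is integrable (for all large \<open>c\<close> in the second case).
\<close>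

end

theory Submission
  imports Defs "HOL-Real_Asymp.Real_Asymp"
begin

text \<open>
  The factor \<open>1 - d ^ (k - 1 - c)\<close> matters only near the end of a block, and these corrections
  form a convergent geometric series; so each user's total delay has mean between \<open>c / q j\<close> and
  \<open>(c + 2) / q j\<close> and, by independence, variance \<open>O(c)\<close>. Since \<open>t \<le> s + t\<^sup>2 / s\<close>,
  taken with \<open>s = sqrt c\<close> for the centred delays, the maximum over the \<open>n\<close> users exceeds the largest
  mean by at most \<open>O(sqrt c)\<close> in expectation, which disappears after division by \<open>c\<close>.
  Both lower bounds compare the maximum with the slowest user.
\<close>

section \<open>Moments of the geometric distribution\<close>

text \<open>Termwise differentiation of the series of \<open>k * z ^ k\<close> with value
  \<open>z / (1 - z)\<^sup>2\<close>: \<open>diffs\<close> multiplies the coefficient at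
  \<open>Suc k\<close> by \<open>Suc k\<close>, which produces the square.\<close>

lemma geometric_second_deriv_sums:
  fixes z :: "'a :: {real_normed_field,banach}"
  assumes "norm z < 1"
  shows "(\<lambda>k. of_nat (Suc k) ^ 2 * z ^ k) sums ((1 + z) / (1 - z) ^ 3)"
proof -
  have "1 - z \<noteq> 0"
    using assms by auto
  then have "((\<lambda>z. z / (1 - z)\<^sup>2) has_field_derivative (1 + z) / (1 - z) ^ 3) (at z)"
    by (auto intro!: derivative_eq_intros simp: divide_simps) algebra
  moreover have "(\<lambda>k. of_nat k * w ^ k) sums (w / (1 - w)\<^sup>2)" if "norm w < 1" for w :: 'a
    using geometric_sums_times_n[OF that] by (simp add: mult.commute)
  ultimately have "(\<lambda>k. diffs of_nat k * z ^ k) sums ((1 + z) / (1 - z) ^ 3)"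
    using assms by (intro termdiffs_sums_strong)
  then show ?thesis
    by (simp add: diffs_def power2_eq_square)
qed

text \<open>For nonnegative terms convergence of the series is absolute convergence, that is,
  integrability for the counting measure; the density \<open>pmf P\<close> is then absorbed into the
  measure. Integrability and value are obtained together.\<close>

lemma has_bochner_integral_pmf_nat:
  fixes f :: "nat \<Rightarrow> real"
  assumes nonneg: "\<And>k. 0 \<le> f k" and sums: "(\<lambda>k. pmf P k * f k) sums s"
  shows "has_bochner_integral (measure_pmf P) f s"
proof -
  have "has_bochner_integral (count_space UNIV) (\<lambda>k. pmf P k *\<^sub>R f k) s"
    using sums nonneg
    by (auto simp: has_bochner_integral_iff integrable_count_space_nat_iff sums_iff
        integral_count_space_nat)
  then show ?thesis
    unfolding measure_pmf_eq_density by (intro has_bochner_integral_density) auto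
qed

text \<open>Since \<open>Geo\<close> shifts the number of failures by one, both moments are
  \<open>p\<close> times a power series in \<open>1 - p\<close>, with coefficients
  \<open>Suc k\<close> and its square.\<close>

lemma Geo_moments:
  assumes "0 < p" "p \<le> 1"
  shows "has_bochner_integral (Geo p) real (1 / p)"
    and "has_bochner_integral (Geo p) (\<lambda>k. (real k)\<^sup>2) ((2 - p) / p\<^sup>2)"
proof -
  have p: "norm (1 - p) < 1" using assms by auto
  have "(\<lambda>k. p * (real (Suc k) * (1 - p) ^ k)) sums (p * (1 / (1 - (1 - p))\<^sup>2))"
    by (intro sums_mult geometric_deriv_sums p)
  then have "(\<lambda>k. pmf (geometric_pmf p) k * real (Suc k)) sums (1 / p)"
    using assms by (simp add: power2_eq_square mult_ac)
  then have "has_bochner_integral (geometric_pmf p) (\<lambda>k. real (Suc k)) (1 / p)"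
    by (intro has_bochner_integral_pmf_nat) auto
  then show "has_bochner_integral (Geo p) real (1 / p)"
    unfolding Geo_def map_pmf_rep_eq
    by (intro has_bochner_integral_distr) auto
  have "(\<lambda>k. p * (real (Suc k) ^ 2 * (1 - p) ^ k)) sums (p * ((1 + (1 - p)) / (1 - (1 - p)) ^ 3))"
    by (intro sums_mult geometric_second_deriv_sums p)
  also have "p * ((1 + (1 - p)) / (1 - (1 - p)) ^ 3) = (2 - p) / p\<^sup>2"
    using assms by (simp add: power2_eq_square power3_eq_cube)
  also have "(\<lambda>k. p * (real (Suc k) ^ 2 * (1 - p) ^ k))
      = (\<lambda>k. pmf (geometric_pmf p) k * (real (Suc k))\<^sup>2)"
    using assms by (simp add: mult_ac)
  finally have "has_bochner_integral (geometric_pmf p) (\<lambda>k. (real (Suc k))\<^sup>2) ((2 - p) / p\<^sup>2)"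
    by (intro has_bochner_integral_pmf_nat) auto
  then show "has_bochner_integral (Geo p) (\<lambda>k. (real k)\<^sup>2) ((2 - p) / p\<^sup>2)"
    unfolding Geo_def map_pmf_rep_eq
    by (intro has_bochner_integral_distr) auto
qed

lemma (in prob_space) geometric_rv_moments:
  assumes V: "geometric_rv M V p" and p: "0 < p" "p \<le> 1"
  shows "integrable M (\<lambda>\<omega>. real (V \<omega>))"
    and "integrable M (\<lambda>\<omega>. (real (V \<omega>))\<^sup>2)"
    and "expectation (\<lambda>\<omega>. real (V \<omega>)) = 1 / p"
    and "variance (\<lambda>\<omega>. real (V \<omega>)) = (1 - p) / p\<^sup>2"
proof -
  have meas [measurable]: "V \<in> measurable M (count_space UNIV)"
    and distr: "distr M (count_space UNIV) V = measure_pmf (Geo p)"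
    using V by (auto simp: geometric_rv_def)
  note m = Geo_moments[OF p, unfolded distr[symmetric] has_bochner_integral_iff]
  show int: "integrable M (\<lambda>\<omega>. real (V \<omega>))" and int2: "integrable M (\<lambda>\<omega>. (real (V \<omega>))\<^sup>2)"
    and ex: "expectation (\<lambda>\<omega>. real (V \<omega>)) = 1 / p"
    using m by (simp_all add: integrable_distr_eq integral_distr)
  have "expectation (\<lambda>\<omega>. (real (V \<omega>))\<^sup>2) = (2 - p) / p\<^sup>2"
    using m by (simp add: integral_distr)
  then show "variance (\<lambda>\<omega>. real (V \<omega>)) = (1 - p) / p\<^sup>2"
    using p by (subst variance_eq[OF int int2]) (simp add: ex field_simps power2_eq_square)
qed

section \<open>Sums and maxima of square-integrable variables\<close>

text \<open>Prepares the extraction of one user's row from a family indexed by pairs. Injectivity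
  turns a finite subfamily over \<open>J\<close> into one over the image of \<open>J\<close> with
  the same intersection and the same product.\<close>

lemma (in prob_space) indep_sets_reindex:
  assumes inj: "inj_on f I" and indep: "indep_sets F (f ` I)"
  shows "indep_sets (\<lambda>i. F (f i)) I"
proof (rule indep_setsI)
  fix i assume "i \<in> I"
  then show "F (f i) \<subseteq> events" using indep by (auto simp: indep_sets_def)
next
  fix A J assume J: "J \<noteq> {}" "J \<subseteq> I" "finite J" and A: "\<forall>j\<in>J. A j \<in> F (f j)"
  have inj_J: "inj_on f J" using inj J(2) by (rule inj_on_subset)
  \<comment> \<open>The events \<open>A\<close> are carried along \<open>f\<close>, so that
    independence over the image applies to them.\<close>
  define B where "B = A \<circ> the_inv_into J f"
  have B: "B (f j) = A j" if "j \<in> J" for j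
    using that inj_J by (simp add: B_def the_inv_into_f_f)
  have "prob (\<Inter>j\<in>f ` J. B j) = (\<Prod>j\<in>f ` J. prob (B j))"
    using J A B by (intro indep_setsD[OF indep]) auto
  then show "prob (\<Inter>j\<in>J. A j) = (\<Prod>j\<in>J. prob (A j))"
    using B by (simp add: prod.reindex[OF inj_J] cong: prod.cong INF_cong)
qed

lemma (in prob_space) indep_vars_reindex:
  assumes "inj_on f I" and "indep_vars M' X (f ` I)"
  shows "indep_vars (\<lambda>i. M' (f i)) (\<lambda>i. X (f i)) I"
  using assms indep_sets_reindex[of f I "\<lambda>i. {X i -` A \<inter> space M |A. A \<in> sets (M' i)}"]
  by (auto simp: indep_vars_def2)

text \<open>Induction on \<open>I\<close>: in the expanded square the cross term is a product of
  independent centred variables and has mean \<open>0\<close>. The form with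
  \<open>has_bochner_integral\<close> carries integrability of the squared sum through the
  induction.\<close>

lemma (in prob_space) indep_vars_sum_square:
  fixes Y :: "'i \<Rightarrow> 'a \<Rightarrow> real"
  assumes "finite I" and "indep_vars (\<lambda>_. borel) Y I"
    and "\<And>i. i \<in> I \<Longrightarrow> integrable M (Y i)"
    and "\<And>i. i \<in> I \<Longrightarrow> integrable M (\<lambda>\<omega>. (Y i \<omega>)\<^sup>2)"
    and "\<And>i. i \<in> I \<Longrightarrow> expectation (Y i) = 0"
  shows "has_bochner_integral M (\<lambda>\<omega>. (\<Sum>i\<in>I. Y i \<omega>)\<^sup>2) (\<Sum>i\<in>I. expectation (\<lambda>\<omega>. (Y i \<omega>)\<^sup>2))"
  using assms
proof (induction I rule: finite_induct)
  case empty
  then show ?case by (simp add: has_bochner_integral_zero)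
next
  case (insert i I)
  let ?S = "\<lambda>\<omega>. \<Sum>i\<in>I. Y i \<omega>"
  have IH: "has_bochner_integral M (\<lambda>\<omega>. (?S \<omega>)\<^sup>2) (\<Sum>i\<in>I. expectation (\<lambda>\<omega>. (Y i \<omega>)\<^sup>2))"
    using insert.prems by (intro insert.IH) (auto intro: indep_vars_subset)
  have S: "integrable M ?S"
    using insert.prems by auto
  have indep: "indep_var borel (Y i) borel ?S"
    using insert by (intro indep_vars_sum) auto
  have Yi: "integrable M (Y i)" and Yi2: "integrable M (\<lambda>\<omega>. (Y i \<omega>)\<^sup>2)"
    and "expectation (Y i) = 0"
    using insert.prems by auto
  then have cross: "has_bochner_integral M (\<lambda>\<omega>. Y i \<omega> * ?S \<omega>) 0"
    using indep_var_integrable[OF indep Yi S] indep_var_lebesgue_integral[OF indep Yi S]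
    by (simp add: has_bochner_integral_iff)
  have "has_bochner_integral M (\<lambda>\<omega>. (Y i \<omega>)\<^sup>2 + (?S \<omega>)\<^sup>2 + 2 * (Y i \<omega> * ?S \<omega>))
     (expectation (\<lambda>\<omega>. (Y i \<omega>)\<^sup>2) + (\<Sum>i\<in>I. expectation (\<lambda>\<omega>. (Y i \<omega>)\<^sup>2)) + 2 * 0)"
    by (intro has_bochner_integral_add has_bochner_integral_mult_right IH cross)
       (use Yi2 in \<open>auto simp: has_bochner_integral_iff\<close>)
  then show ?case
    using insert.hyps by (simp add: power2_sum mult.assoc)
qed

text \<open>Centring each summand preserves independence, and by linearity the centred summands add
  up to the sum minus its mean.\<close>

lemma (in prob_space) indep_vars_variance_sum:
  fixes Y :: "'i \<Rightarrow> 'a \<Rightarrow> real"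
  assumes fin: "finite I" and indep: "indep_vars (\<lambda>_. borel) Y I"
    and int: "\<And>i. i \<in> I \<Longrightarrow> integrable M (Y i)"
    and int2: "\<And>i. i \<in> I \<Longrightarrow> integrable M (\<lambda>\<omega>. (Y i \<omega>)\<^sup>2)"
  shows "has_bochner_integral M (\<lambda>\<omega>. ((\<Sum>i\<in>I. Y i \<omega>) - expectation (\<lambda>\<omega>. \<Sum>i\<in>I. Y i \<omega>))\<^sup>2)
           (\<Sum>i\<in>I. variance (Y i))"
proof -
  let ?Y = "\<lambda>i \<omega>. Y i \<omega> - expectation (Y i)"
  have "has_bochner_integral M (\<lambda>\<omega>. (\<Sum>i\<in>I. ?Y i \<omega>)\<^sup>2) (\<Sum>i\<in>I. variance (Y i))"
  proof (rule indep_vars_sum_square[OF fin])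
    show "indep_vars (\<lambda>_. borel) ?Y I"
      by (rule indep_vars_compose2[OF indep]) auto
    fix i assume i: "i \<in> I"
    show "integrable M (?Y i)" using int[OF i] by auto
    show "integrable M (\<lambda>\<omega>. (?Y i \<omega>)\<^sup>2)"
      using int[OF i] int2[OF i] by (simp add: power2_diff)
    show "expectation (?Y i) = 0" using int[OF i] by (simp add: prob_space)
  qed
  then show ?thesis
    using int by (simp add: sum_subtractf)
qed

lemma real_MAX:
  assumes "finite I" "I \<noteq> {}"
  shows "real (MAX i\<in>I. f i) = (MAX i\<in>I. real (f i))"
  using mono_Max_commute[of real "f ` I"] assms by (simp add: mono_def image_image)

lemma (in prob_space) integrable_real_MAX:
  fixes V :: "'i \<Rightarrow> 'a \<Rightarrow> nat"
  assumes "finite I" "I \<noteq> {}" "\<And>i. i \<in> I \<Longrightarrow> integrable M (\<lambda>\<omega>. real (V i \<omega>))"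
  shows "integrable M (\<lambda>\<omega>. real (MAX i\<in>I. V i \<omega>))"
  using assms by (simp add: real_MAX integrable_MAX)

lemma (in prob_space) expectation_le_MAX:
  fixes V :: "'i \<Rightarrow> 'a \<Rightarrow> nat"
  assumes "finite I" "i \<in> I" "\<And>i. i \<in> I \<Longrightarrow> integrable M (\<lambda>\<omega>. real (V i \<omega>))"
  shows "expectation (\<lambda>\<omega>. real (V i \<omega>)) \<le> expectation (\<lambda>\<omega>. real (MAX i\<in>I. V i \<omega>))"
  using assms by (intro integral_mono integrable_real_MAX) auto

text \<open>Each variable is at most \<open>m\<close> plus its deviation, and a deviation is at most
  \<open>s\<close> plus its square over \<open>s\<close>. Summing the squares over \<open>I\<close>
  gives one bound for the maximum, at the cost of \<open>card I * v / s\<close> in expectation;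
  \<open>s\<close> stays free for balancing.\<close>

lemma (in prob_space) expectation_MAX_le:
  fixes V :: "'i \<Rightarrow> 'a \<Rightarrow> nat" and m v s :: real
  assumes I: "finite I" "I \<noteq> {}"
    and int: "\<And>i. i \<in> I \<Longrightarrow> integrable M (\<lambda>\<omega>. real (V i \<omega>))"
    and int2: "\<And>i. i \<in> I \<Longrightarrow>
      integrable M (\<lambda>\<omega>. (real (V i \<omega>) - expectation (\<lambda>\<omega>. real (V i \<omega>)))\<^sup>2)"
    and mean: "\<And>i. i \<in> I \<Longrightarrow> expectation (\<lambda>\<omega>. real (V i \<omega>)) \<le> m"
    and var: "\<And>i. i \<in> I \<Longrightarrow> variance (\<lambda>\<omega>. real (V i \<omega>)) \<le> v"
    and s: "0 < s"
  shows "expectation (\<lambda>\<omega>. real (MAX i\<in>I. V i \<omega>)) \<le> m + s + card I * v / s"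
proof -
  let ?D = "\<lambda>i \<omega>. (real (V i \<omega>) - expectation (\<lambda>\<omega>. real (V i \<omega>)))\<^sup>2"
  have dev: "t \<le> s + t\<^sup>2 / s" for t :: real
  proof (cases "t \<le> s")
    case True
    then show ?thesis using s by (simp add: add_increasing2)
  next
    case False
    then have "t * s \<le> t * t" using s by (intro mult_left_mono) auto
    then have "t \<le> t\<^sup>2 / s" using s by (simp add: field_simps power2_eq_square)
    then show ?thesis using s by simp
  qed
  have "expectation (\<lambda>\<omega>. real (MAX i\<in>I. V i \<omega>)) \<le> expectation (\<lambda>\<omega>. m + s + (\<Sum>i\<in>I. ?D i \<omega>) / s)"
  proof (rule integral_mono)
    show "integrable M (\<lambda>\<omega>. real (MAX i\<in>I. V i \<omega>))"
      by (rule integrable_real_MAX[OF I int])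
    show "integrable M (\<lambda>\<omega>. m + s + (\<Sum>i\<in>I. ?D i \<omega>) / s)"
      using int2 by auto
    fix \<omega>
    have "real (V i \<omega>) \<le> m + s + (\<Sum>i\<in>I. ?D i \<omega>) / s" if i: "i \<in> I" for i
    proof -
      have "?D i \<omega> / s \<le> (\<Sum>i\<in>I. ?D i \<omega>) / s"
        using s I i by (intro divide_right_mono member_le_sum) auto
      then show ?thesis
        using dev[of "real (V i \<omega>) - expectation (\<lambda>\<omega>. real (V i \<omega>))"] mean[OF i] by linarith
    qed
    then show "real (MAX i\<in>I. V i \<omega>) \<le> m + s + (\<Sum>i\<in>I. ?D i \<omega>) / s"
      using I by (simp add: real_MAX)
  qed
  also have "\<dots> = m + s + (\<Sum>i\<in>I. expectation (?D i)) / s"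
    using int2 by (simp add: prob_space)
  also have "\<dots> \<le> m + s + (\<Sum>i\<in>I. v) / s"
    using s var by (intro add_left_mono divide_right_mono sum_mono) auto
  finally show ?thesis by simp
qed

section \<open>Total delay of one user\<close>

text \<open>The correction is at most \<open>(1 / 2) ^ (Suc c - k)\<close> because
  \<open>d \<ge> 2\<close>, hence at most \<open>1 / 2\<close> because \<open>k \<le> c\<close>. The
  bound \<open>q / 2 \<le> p\<close> serves the variance, \<open>p \<le> q\<close> the lower bound
  on the mean, and the third leaves an excess over \<open>1 / q\<close> whose sum over
  \<open>k\<close> is bounded uniformly in \<open>c\<close>.\<close>

lemma coded_success_prob_bounds:
  fixes d c k :: nat and q :: real
  assumes d: "2 \<le> d" and k: "k \<in> {1..c}" and q: "0 < q"
  defines "p \<equiv> (1 - real d powi (int k - 1 - int c)) * q"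
  shows "q / 2 \<le> p" "p \<le> q" "1 / p \<le> (1 + 2 * (1 / 2) ^ (Suc c - k)) / q"
proof -
  define r where "r = real d powi (int k - 1 - int c)"
  have "r = real d powi (- int (Suc c - k))"
    unfolding r_def using k by (intro arg_cong[where f = "\<lambda>e. real d powi e"]) auto
  then have "r = (1 / real d) ^ (Suc c - k)"
    by (simp add: power_int_minus power_one_over inverse_eq_divide)
  moreover have "(1 / real d) ^ (Suc c - k) \<le> (1 / 2) ^ (Suc c - k)"
    using d by (intro power_mono) (auto simp: field_simps)
  moreover have "(1 / 2 :: real) ^ (Suc c - k) \<le> (1 / 2) ^ 1"
    using k by (intro power_decreasing) auto
  ultimately have r: "0 \<le> r" "r \<le> (1 / 2) ^ (Suc c - k)" "r \<le> 1 / 2"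
    by auto
  have p: "p = (1 - r) * q" by (simp add: p_def r_def)
  have "1 / 2 * q \<le> (1 - r) * q" "(1 - r) * q \<le> 1 * q"
    using r q by (intro mult_right_mono; simp)+
  then show "q / 2 \<le> p" "p \<le> q" by (auto simp: p)
  \<comment> \<open>This is \<open>1 \<le> (1 + 2 * r) * (1 - r)\<close>, rearranged; it relies on
    \<open>r \<le> 1 / 2\<close>.\<close>
  have "0 \<le> r * (1 - 2 * r)" using r by auto
  then have "1 / (1 - r) \<le> 1 + 2 * r"
    using r by (simp add: divide_le_eq algebra_simps)
  then have "1 / (1 - r) / q \<le> (1 + 2 * (1 / 2) ^ (Suc c - k)) / q"
    using r q by (intro divide_right_mono) auto
  then show "1 / p \<le> (1 + 2 * (1 / 2) ^ (Suc c - k)) / q"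
    by (simp add: p)
qed

text \<open>Reversing the order of summation gives a geometric sum equal to
  \<open>1 - (1 / 2) ^ c\<close>.\<close>

lemma sum_half_powers_le: "(\<Sum>k = 1..c. (1 / 2 :: real) ^ (Suc c - k)) \<le> 1"
proof -
  have "(\<Sum>k = 1..c. (1 / 2 :: real) ^ (Suc c - k)) = (\<Sum>k = 1..c. (1 / 2) ^ k)"
    by (rule sum.reindex_bij_witness[of _ "\<lambda>k. Suc c - k" "\<lambda>k. Suc c - k"]) auto
  also have "\<dots> = 1 - (1 / 2) ^ c"
    by (induction c) (auto simp: field_simps)
  finally show ?thesis by simp
qed

text \<open>The corrections shift the mean by a constant independent of \<open>c\<close>, while the
  variance grows at most linearly, so the fluctuations are of order \<open>sqrt c\<close>,
  negligible against \<open>c\<close>.\<close>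

lemma (in prob_space) coded_delay_moments:
  fixes d c :: nat and q :: real and V :: "nat \<Rightarrow> 'a \<Rightarrow> nat"
  assumes d: "2 \<le> d" and q: "0 < q" "q < 1"
    and geo: "\<And>k. k \<in> {1..c} \<Longrightarrow> geometric_rv M (V k) ((1 - real d powi (int k - 1 - int c)) * q)"
    and indep: "indep_vars (\<lambda>_. borel) (\<lambda>k \<omega>. real (V k \<omega>)) {1..c}"
  defines "S \<equiv> \<lambda>\<omega>. real (\<Sum>k = 1..c. V k \<omega>)"
  shows "integrable M S"
    and "integrable M (\<lambda>\<omega>. (S \<omega> - expectation S)\<^sup>2)"
    and "real c / q \<le> expectation S"
    and "expectation S \<le> (real c + 2) / q"
    and "variance S \<le> 4 * real c / q\<^sup>2"
proof -
  define p where "p k = (1 - real d powi (int k - 1 - int c)) * q" for k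
  have p: "q / 2 \<le> p k" "p k \<le> q" "1 / p k \<le> (1 + 2 * (1 / 2) ^ (Suc c - k)) / q"
    if "k \<in> {1..c}" for k
    unfolding p_def using coded_success_prob_bounds[OF d that q(1)] by auto
  have p01: "0 < p k" "p k \<le> 1" if "k \<in> {1..c}" for k
    using p[OF that] q by linarith+
  note m = geometric_rv_moments[OF geo[folded p_def] p01]
  have S: "S = (\<lambda>\<omega>. \<Sum>k = 1..c. real (V k \<omega>))"
    by (simp add: S_def)
  show "integrable M S"
    unfolding S using m(1) by auto
  have ES: "expectation S = (\<Sum>k = 1..c. 1 / p k)"
    unfolding S using m by (simp add: Bochner_Integration.integral_sum)
  have "has_bochner_integral M (\<lambda>\<omega>. (S \<omega> - expectation S)\<^sup>2)
      (\<Sum>k = 1..c. variance (\<lambda>\<omega>. real (V k \<omega>)))"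
    unfolding S using m by (intro indep_vars_variance_sum indep) auto
  then have VS: "has_bochner_integral M (\<lambda>\<omega>. (S \<omega> - expectation S)\<^sup>2)
      (\<Sum>k = 1..c. (1 - p k) / (p k)\<^sup>2)"
    using m(4) by simp
  then show "integrable M (\<lambda>\<omega>. (S \<omega> - expectation S)\<^sup>2)"
    by (simp add: has_bochner_integral_iff)
  have "(\<Sum>k = 1..c. 1 / q) \<le> (\<Sum>k = 1..c. 1 / p k)"
    using p p01 by (intro sum_mono divide_left_mono) (auto intro!: mult_pos_pos q)
  then show "real c / q \<le> expectation S"
    by (simp add: ES)
  have "(\<Sum>k = 1..c. 1 / p k) \<le> (\<Sum>k = 1..c. (1 + 2 * (1 / 2) ^ (Suc c - k)) / q)"
    using p by (intro sum_mono) auto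
  also have "\<dots> = (real c + 2 * (\<Sum>k = 1..c. (1 / 2) ^ (Suc c - k))) / q"
    by (simp add: sum.distrib sum_distrib_left flip: sum_divide_distrib)
  also have "\<dots> \<le> (real c + 2) / q"
    using sum_half_powers_le[of c] q by (intro divide_right_mono) auto
  finally show "expectation S \<le> (real c + 2) / q"
    by (simp add: ES)
  \<comment> \<open>The numerator is at most \<open>1\<close> and \<open>p k\<close> is at least
    \<open>q / 2\<close>; this is where the factor \<open>4\<close> comes from.\<close>
  have "(1 - p k) / (p k)\<^sup>2 \<le> 1 / (q / 2)\<^sup>2" if "k \<in> {1..c}" for k
    using p[OF that] p01[OF that] q by (intro frac_le power_mono) auto
  then have "(\<Sum>k = 1..c. (1 - p k) / (p k)\<^sup>2) \<le> (\<Sum>k = 1..c. 1 / (q / 2)\<^sup>2)"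
    by (intro sum_mono)
  also have "\<dots> = 4 * real c / q\<^sup>2"
    by (simp add: power_divide)
  finally show "variance S \<le> 4 * real c / q\<^sup>2"
    using VS by (simp add: has_bochner_integral_iff)
qed

section \<open>Limit of the coded delay per packet and comparison with uncoded transmission\<close>

theorem proposition15:
  fixes n d :: nat
    and q :: "nat \<Rightarrow> real"
    and M :: "nat \<Rightarrow> 'a measure" and X :: "nat \<Rightarrow> nat \<Rightarrow> nat \<Rightarrow> 'a \<Rightarrow> nat"
    and N :: "'b measure" and Z :: "nat \<Rightarrow> 'b \<Rightarrow> nat"
  assumes n: "n \<ge> 1"
    and q: "\<And>j. j \<in> {1..n} \<Longrightarrow> 0 < q j \<and> q j < 1"
    and d: "d \<ge> 2"
    and M_prob: "\<And>c. c \<ge> 1 \<Longrightarrow> prob_space (M c)"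
    and X_geo: "\<And>c j k. c \<ge> 1 \<Longrightarrow> j \<in> {1..n} \<Longrightarrow> k \<in> {1..c} \<Longrightarrow>
           geometric_rv (M c) (X c j k) ((1 - real d powi (int k - 1 - int c)) * q j)"
    and X_indep: "\<And>c. c \<ge> 1 \<Longrightarrow>
           prob_space.indep_vars (M c) (\<lambda>_. count_space UNIV) (\<lambda>(j, k). X c j k) ({1..n} \<times> {1..c})"
    and N_prob: "prob_space N"
    and Z_geo: "\<And>j. j \<in> {1..n} \<Longrightarrow> geometric_rv N (Z j) (q j)"
    and Z_indep: "prob_space.indep_vars N (\<lambda>_. count_space UNIV) Z {1..n}"
  shows "((\<lambda>c. prob_space.expectation (M c) (\<lambda>\<omega>. real (MAX j\<in>{1..n}. \<Sum>k=1..c. X c j k \<omega>)) / real c)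
            \<longlonglongrightarrow> 1 / (MIN j\<in>{1..n}. q j))
         \<and> 1 / (MIN j\<in>{1..n}. q j) \<le> prob_space.expectation N (\<lambda>\<omega>. real (MAX j\<in>{1..n}. Z j \<omega>))"
proof
  define q0 where "q0 = (MIN j\<in>{1..n}. q j)"
  \<comment> \<open>The minimum is attained; the slowest user \<open>i\<close> serves both lower
    bounds.\<close>
  have "q0 \<in> q ` {1..n}"
    unfolding q0_def using n by (intro Min_in) auto
  then obtain i where i: "i \<in> {1..n}" "q i = q0" by auto
  have q0: "0 < q0" using q i by auto
  have q0_le: "q0 \<le> q j" if "j \<in> {1..n}" for j
    unfolding q0_def using that by (intro Min_le) auto
  \<comment> \<open>For \<open>s = sqrt c\<close> the errors \<open>s\<close> and
    \<open>n * (4 * c / q0\<^sup>2) / s\<close> are both of order \<open>sqrt c\<close>, which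
    explains the coefficient of \<open>sqrt c\<close>.\<close>
  have bounds: "real c / q0 \<le> prob_space.expectation (M c) (\<lambda>\<omega>. real (MAX j\<in>{1..n}. \<Sum>k=1..c. X c j k \<omega>))
      \<and> prob_space.expectation (M c) (\<lambda>\<omega>. real (MAX j\<in>{1..n}. \<Sum>k=1..c. X c j k \<omega>))
        \<le> (real c + 2) / q0 + (1 + 4 * n / q0\<^sup>2) * sqrt c"
    if c: "c \<ge> 1" for c
  proof -
    interpret prob_space "M c" using M_prob[OF c] .
    have indep: "indep_vars (\<lambda>_. borel) (\<lambda>k \<omega>. real (X c j k \<omega>)) {1..c}" if j: "j \<in> {1..n}" for j
    proof -
      \<comment> \<open>Row \<open>j\<close> of the index grid is the image of \<open>{1..c}\<close>
        under the injection \<open>Pair j\<close>.\<close>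
      have "indep_vars (\<lambda>_. count_space UNIV) (\<lambda>(j, k). X c j k) (Pair j ` {1..c})"
        using j by (intro indep_vars_subset[OF X_indep[OF c]]) auto
      from indep_vars_reindex[OF _ this]
      have "indep_vars (\<lambda>_. count_space UNIV) (X c j) {1..c}"
        by (simp add: inj_on_def)
      then show ?thesis
        by (rule indep_vars_compose2) simp
    qed
    have m: "integrable (M c) (\<lambda>\<omega>. real (\<Sum>k=1..c. X c j k \<omega>))"
      "integrable (M c) (\<lambda>\<omega>. (real (\<Sum>k=1..c. X c j k \<omega>)
         - expectation (\<lambda>\<omega>. real (\<Sum>k=1..c. X c j k \<omega>)))\<^sup>2)"
      "real c / q j \<le> expectation (\<lambda>\<omega>. real (\<Sum>k=1..c. X c j k \<omega>))"
      "expectation (\<lambda>\<omega>. real (\<Sum>k=1..c. X c j k \<omega>)) \<le> (real c + 2) / q j"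
      "variance (\<lambda>\<omega>. real (\<Sum>k=1..c. X c j k \<omega>)) \<le> 4 * real c / (q j)\<^sup>2"
      if j: "j \<in> {1..n}" for j
      using coded_delay_moments[OF d _ _ X_geo[OF c j] indep[OF j]] q[OF j] by auto
    have "real c / q0 \<le> expectation (\<lambda>\<omega>. real (\<Sum>k=1..c. X c i k \<omega>))"
      using m(3)[OF i(1)] i by simp
    also have "\<dots> \<le> expectation (\<lambda>\<omega>. real (MAX j\<in>{1..n}. \<Sum>k=1..c. X c j k \<omega>))"
      using i m(1) by (intro expectation_le_MAX) auto
    finally have lower: "real c / q0 \<le> expectation (\<lambda>\<omega>. real (MAX j\<in>{1..n}. \<Sum>k=1..c. X c j k \<omega>))" .
    have "expectation (\<lambda>\<omega>. real (MAX j\<in>{1..n}. \<Sum>k=1..c. X c j k \<omega>))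
        \<le> (real c + 2) / q0 + sqrt c + card {1..n} * (4 * real c / q0\<^sup>2) / sqrt c"
    proof (rule expectation_MAX_le[OF _ _ m(1) m(2)])
      \<comment> \<open>Replacing \<open>q j\<close> by the smaller \<open>q0\<close> makes the
        bounds on mean and variance uniform in \<open>j\<close>.\<close>
      fix j assume j: "j \<in> {1..n}"
      have "(real c + 2) / q j \<le> (real c + 2) / q0"
        using q0 q0_le[OF j] by (intro frac_le) auto
      with m(4)[OF j] show "expectation (\<lambda>\<omega>. real (\<Sum>k=1..c. X c j k \<omega>)) \<le> (real c + 2) / q0"
        by linarith
      have "4 * real c / (q j)\<^sup>2 \<le> 4 * real c / q0\<^sup>2"
        using q0 q0_le[OF j] by (intro frac_le power_mono) auto
      with m(5)[OF j] show "variance (\<lambda>\<omega>. real (\<Sum>k=1..c. X c j k \<omega>)) \<le> 4 * real c / q0\<^sup>2"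
        by linarith
    qed (use c n in auto)
    also have "\<dots> = (real c + 2) / q0 + sqrt c + 4 * n / q0\<^sup>2 * (real c / sqrt c)"
      by simp
    also have "real c / sqrt c = sqrt c"
      by (simp add: real_div_sqrt)
    finally show ?thesis
      using lower by (simp add: algebra_simps)
  qed
  have "((\<lambda>c. prob_space.expectation (M c) (\<lambda>\<omega>. real (MAX j\<in>{1..n}. \<Sum>k=1..c. X c j k \<omega>)) / real c)
      \<longlonglongrightarrow> 1 / q0)"
  proof (rule tendsto_sandwich[OF _ _ tendsto_const])
    \<comment> \<open>The excess over \<open>1 / q0\<close> is \<open>2 / (q0 * c)\<close> plus a
      constant times \<open>1 / sqrt c\<close>.\<close>
    show "(\<lambda>c. ((real c + 2) / q0 + (1 + 4 * n / q0\<^sup>2) * sqrt c) / real c) \<longlonglongrightarrow> 1 / q0"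
      using q0 by (real_asymp simp: inverse_eq_divide)
    show "\<forall>\<^sub>F c in sequentially. 1 / q0
        \<le> prob_space.expectation (M c) (\<lambda>\<omega>. real (MAX j\<in>{1..n}. \<Sum>k=1..c. X c j k \<omega>)) / real c"
      \<comment> \<open>The bounds were established for \<open>c \<ge> 1\<close>, where multiplying
        out the division by \<open>c\<close> is also legitimate.\<close>
      using eventually_ge_at_top[of 1]
    proof eventually_elim
      case (elim c)
      then show ?case using bounds[OF elim] by (simp add: field_simps)
    qed
    show "\<forall>\<^sub>F c in sequentially.
        prob_space.expectation (M c) (\<lambda>\<omega>. real (MAX j\<in>{1..n}. \<Sum>k=1..c. X c j k \<omega>)) / real c
        \<le> ((real c + 2) / q0 + (1 + 4 * n / q0\<^sup>2) * sqrt c) / real c"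
      using eventually_ge_at_top[of 1]
    proof eventually_elim
      case (elim c)
      then show ?case using bounds[OF elim] by (intro divide_right_mono) auto
    qed
  qed
  then show "((\<lambda>c. prob_space.expectation (M c) (\<lambda>\<omega>. real (MAX j\<in>{1..n}. \<Sum>k=1..c. X c j k \<omega>)) / real c)
      \<longlonglongrightarrow> 1 / (MIN j\<in>{1..n}. q j))"
    by (simp add: q0_def)
  interpret N: prob_space N by (rule N_prob)
  have Z: "integrable N (\<lambda>\<omega>. real (Z j \<omega>))" "N.expectation (\<lambda>\<omega>. real (Z j \<omega>)) = 1 / q j"
    if j: "j \<in> {1..n}" for j
    using N.geometric_rv_moments[OF Z_geo[OF j]] q[OF j] by auto
  show "1 / (MIN j\<in>{1..n}. q j) \<le> N.expectation (\<lambda>\<omega>. real (MAX j\<in>{1..n}. Z j \<omega>))"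
    \<comment> \<open>User \<open>i\<close> alone already has mean delay
      \<open>1 / q0\<close>.\<close>
    using N.expectation_le_MAX[of "{1..n}" i Z] Z i by (simp add: q0_def)
qed

end
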